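(* Let $\{X_n(V_n,E_n)\}_{n=1}^{\infty}$ be an infinite sequence of expanding graphs. Endow the disjoint union $\bigcup_n X_n$ with a metric whose restriction to each connected component of each $X_n$ is the natural path metric and such that $d(X_i,X_j)>i+j$ whenever $i\neq j$, and let $V=\bigcup_n V_n\subseteq\bigcup_n X_n$ be given the subspace metric. Then the metric space $V$ does not have the operator norm localization property.
   Context: Expanding graphs: for a finite graph $X=X(V,E)$ with vertex set $V$ and edge set $E$, the Cheeger constant is $h(X)=\inf \frac{|E(A,B)|}{\min(|A|,|B|)}$, the infimum over all partitions $V=A\sqcup B$ into disjoint nonempty subsets, where $E(A,B)$ is the set of edges connecting vertices in $A$ to vertices in $B$. An infinite sequence of finite graphs $\{X_n(V_n,E_n)\}_n$ of (uniformly) bounded degree is a sequence of expanding graphs if there is $h>0$ with $h(X_n)\ge h$ for all $n$ and $|V_n|\to\infty$ as $n\to\infty$. Operator norm localization: let $H$ be a separable infinite-dimensional Hilbert space. A Borel measure on a metric space is locally finite if bounded Borel sets have finite measure; positive measures here are understood to be nonzero. For a positive locally finite Borel measure $\nu$ on a metric space $X$, a bounded operator $T$ on $L^2(X,\nu)\otimes H$ has propagation at most $r$ if $\langle T\varphi,\psi\rangle=0$ whenever $d(\mathrm{Supp}(\varphi),\mathrm{Supp}(\psi))>r$; $\mathcal{A}_r(X,\nu)$ is the set of such operators. $X$ has the operator norm localization property if there are $0<c\le 1$ and a non-decreasing $f:\mathbf{N}\to\mathbf{N}$ such that for every positive locally finite Borel measure $\nu$ on $X$, every $k\in\mathbf{N}$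 and every $T\in\mathcal{A}_k(X,\nu)$ there is a nonzero $\varphi\in L^2(X,\nu)\otimes H$ with $\mathrm{Diam}(\mathrm{Supp}(\varphi))\le f(k)$ and $\|T\varphi\|\ge c\|T\|\|\varphi\|$. *)

theory Defs
  imports "HOL-Analysis.Analysis"
begin

subsection \<open>Complex Hilbert spaces\<close>

class complex_hilbert_space = banach +
  fixes scaleC :: "complex \<Rightarrow> 'a \<Rightarrow> 'a"
    and cinner :: "'a \<Rightarrow> 'a \<Rightarrow> complex"
  assumes scaleC_add_right: "scaleC a (x + y) = scaleC a x + scaleC a y"
    and scaleC_add_left: "scaleC (a + b) x = scaleC a x + scaleC b x"
    and scaleC_scaleC: "scaleC a (scaleC b x) = scaleC (a * b) x"
    and scaleC_one: "scaleC 1 x = x"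
    and scaleC_of_real: "scaleC (complex_of_real r) x = r *\<^sub>R x"
    and cinner_commute: "cinner x y = cnj (cinner y x)"
    and cinner_add_left: "cinner (x + y) z = cinner x z + cinner y z"
    and cinner_scaleC_left: "cinner (scaleC a x) y = a * cinner x y"
    and cinner_self: "cinner x x = complex_of_real ((norm x)\<^sup>2)"


subsection \<open>Finite graphs and expanding sequences\<close>

definition finite_graph :: "'a set \<Rightarrow> 'a set set \<Rightarrow> bool" where
  "finite_graph V E \<longleftrightarrow> finite V \<and> E \<subseteq> {{u, v} | u v. u \<in> V \<and> v \<in> V \<and> u \<noteq> v}"

definition edges_between :: "'a set set \<Rightarrow> 'a set \<Rightarrow> 'a set \<Rightarrow> 'a set set" where
  "edges_between E A B = {e \<in> E. \<exists>a\<in>A. \<exists>b\<in>B. e = {a, b}}"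

text \<open>The value is \<open>\<infinity>\<close> (an infimum over the empty set) if there are fewer than two vertices.\<close>

definition cheeger :: "'a set \<Rightarrow> 'a set set \<Rightarrow> ereal" where
  "cheeger V E =
     (INF (A, B) \<in> {(A, B). A \<union> B = V \<and> A \<inter> B = {} \<and> A \<noteq> {} \<and> B \<noteq> {}}.
        ereal (real (card (edges_between E A B)) / real (min (card A) (card B))))"

text \<open>Sequences are indexed by \<open>n \<ge> 1\<close>; the values at \<open>0\<close> are irrelevant.\<close>

definition expanding_graphs :: "(nat \<Rightarrow> 'a set) \<Rightarrow> (nat \<Rightarrow> 'a set set) \<Rightarrow> bool" where
  "expanding_graphs V E \<longleftrightarrow>
     (\<forall>n\<ge>1. finite_graph (V n) (E n)) \<and>
     (\<exists>D::nat. \<forall>n\<ge>1. \<forall>v\<in>V n. card {e \<in> E n. v \<in> e} \<le> D) \<and>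
     (\<exists>h::real. h > 0 \<and> (\<forall>n\<ge>1. ereal h \<le> cheeger (V n) (E n))) \<and>
     filterlim (\<lambda>n. card (V n)) at_top sequentially"


subsection \<open>Graphs as metric spaces\<close>

text \<open>A point of the geometric realization is given by its barycentric coordinates; the vertex
  \<open>v\<close> is the point \<open>indicator {v}\<close>.\<close>

definition cell :: "'a set \<Rightarrow> ('a \<Rightarrow> real) set" where
  "cell s = {p. (\<forall>v. 0 \<le> p v) \<and> (\<forall>v. v \<notin> s \<longrightarrow> p v = 0) \<and> (\<Sum>v\<in>s. p v) = 1}"

definition realization :: "'a set \<Rightarrow> 'a set set \<Rightarrow> ('a \<Rightarrow> real) set" where
  "realization V E = (\<Union>v\<in>V. cell {v}) \<union> (\<Union>e\<in>E. cell e)"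

text \<open>On an edge \<open>e = {u, v}\<close> one has \<open>p u + p v = 1\<close>, so the sum below is
  \<open>\<bar>p u - q u\<bar>\<close>: every edge is isometric to the unit interval.\<close>

definition edge_dist :: "'a set \<Rightarrow> ('a \<Rightarrow> real) \<Rightarrow> ('a \<Rightarrow> real) \<Rightarrow> real" where
  "edge_dist e p q = (\<Sum>v\<in>e. \<bar>p v - q v\<bar>) / 2"

text \<open>\<open>graph_path V E p q l\<close>: there is a piecewise linear path of length \<open>l\<close> from \<open>p\<close> to \<open>q\<close>,
  each piece being a segment inside a closed edge.\<close>

inductive graph_path ::
  "'a set \<Rightarrow> 'a set set \<Rightarrow> ('a \<Rightarrow> real) \<Rightarrow> ('a \<Rightarrow> real) \<Rightarrow> real \<Rightarrow> bool"
  for V :: "'a set" and E :: "'a set set" and p :: "'a \<Rightarrow> real" where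
  refl: "p \<in> realization V E \<Longrightarrow> graph_path V E p p 0"
| step: "\<lbrakk>graph_path V E p q l; e \<in> E; q \<in> cell e; r \<in> cell e\<rbrakk>
           \<Longrightarrow> graph_path V E p r (l + edge_dist e q r)"

definition same_component ::
  "'a set \<Rightarrow> 'a set set \<Rightarrow> ('a \<Rightarrow> real) \<Rightarrow> ('a \<Rightarrow> real) \<Rightarrow> bool" where
  "same_component V E p q \<longleftrightarrow> (\<exists>l. graph_path V E p q l)"

definition path_metric ::
  "'a set \<Rightarrow> 'a set set \<Rightarrow> ('a \<Rightarrow> real) \<Rightarrow> ('a \<Rightarrow> real) \<Rightarrow> real" where
  "path_metric V E p q = Inf {l. graph_path V E p q l}"

definition graph_piece ::
  "(nat \<Rightarrow> 'a set) \<Rightarrow> (nat \<Rightarrow> 'a set set) \<Rightarrow> nat \<Rightarrow> (nat \<times> ('a \<Rightarrow> real)) set" where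
  "graph_piece V E n = {n} \<times> realization (V n) (E n)"

definition graph_union ::
  "(nat \<Rightarrow> 'a set) \<Rightarrow> (nat \<Rightarrow> 'a set set) \<Rightarrow> (nat \<times> ('a \<Rightarrow> real)) set" where
  "graph_union V E = (\<Union>n\<in>{1..}. graph_piece V E n)"

definition vertex_union :: "(nat \<Rightarrow> 'a set) \<Rightarrow> (nat \<times> ('a \<Rightarrow> real)) set" where
  "vertex_union V = {(n, indicator {v}) | n v. n \<ge> 1 \<and> v \<in> V n}"

definition set_distance :: "('x \<Rightarrow> 'x \<Rightarrow> real) \<Rightarrow> 'x set \<Rightarrow> 'x set \<Rightarrow> ereal" where
  "set_distance d A B = (INF x\<in>A. INF y\<in>B. ereal (d x y))"

definition set_diameter :: "('x \<Rightarrow> 'x \<Rightarrow> real) \<Rightarrow> 'x set \<Rightarrow> ereal" where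
  "set_diameter d A = (SUP x\<in>A. SUP y\<in>A. ereal (d x y))"


subsection \<open>Operator norm localization\<close>

definition locally_finite_borel_measure ::
  "'x set \<Rightarrow> ('x \<Rightarrow> 'x \<Rightarrow> real) \<Rightarrow> 'x measure \<Rightarrow> bool" where
  "locally_finite_borel_measure M d \<nu> \<longleftrightarrow>
     space \<nu> = M \<and>
     sets \<nu> = sigma_sets M {U. openin (Metric_space.mtopology M d) U} \<and>
     (\<forall>A\<in>sets \<nu>. Metric_space.mbounded M d A \<longrightarrow> emeasure \<nu> A < \<infinity>)"

text \<open>The Hilbert space \<open>L\<^sup>2(X,\<nu>) \<otimes> H\<close> is realized as \<open>L\<^sup>2(X,\<nu>;H)\<close>. Its elements are
  represented by square-integrable functions, equality being equality almost everywhere.\<close>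

definition L2 :: "'x measure \<Rightarrow> ('x \<Rightarrow> 'h::complex_hilbert_space) set" where
  "L2 \<nu> = {\<phi> \<in> borel_measurable \<nu>. integrable \<nu> (\<lambda>x. (norm (\<phi> x))\<^sup>2)}"

definition L2_norm :: "'x measure \<Rightarrow> ('x \<Rightarrow> 'h::complex_hilbert_space) \<Rightarrow> real" where
  "L2_norm \<nu> \<phi> = sqrt (LINT x|\<nu>. (norm (\<phi> x))\<^sup>2)"

definition L2_inner ::
  "'x measure \<Rightarrow> ('x \<Rightarrow> 'h::complex_hilbert_space) \<Rightarrow> ('x \<Rightarrow> 'h) \<Rightarrow> complex" where
  "L2_inner \<nu> \<phi> \<psi> = (LINT x|\<nu>. cinner (\<phi> x) (\<psi> x))"

text \<open>A bounded operator acts on representatives. Linearity and boundedness together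
  imply that it respects equality almost everywhere.\<close>

definition L2_bounded_operator ::
  "'x measure \<Rightarrow> (('x \<Rightarrow> 'h::complex_hilbert_space) \<Rightarrow> ('x \<Rightarrow> 'h)) \<Rightarrow> bool" where
  "L2_bounded_operator \<nu> T \<longleftrightarrow>
     (\<forall>\<phi>\<in>L2 \<nu>. T \<phi> \<in> L2 \<nu>) \<and>
     (\<forall>\<phi>\<in>L2 \<nu>. \<forall>\<psi>\<in>L2 \<nu>. AE x in \<nu>. T (\<lambda>y. \<phi> y + \<psi> y) x = T \<phi> x + T \<psi> x) \<and>
     (\<forall>a. \<forall>\<phi>\<in>L2 \<nu>. AE x in \<nu>. T (\<lambda>y. scaleC a (\<phi> y)) x = scaleC a (T \<phi> x)) \<and>
     (\<exists>K. \<forall>\<phi>\<in>L2 \<nu>. L2_norm \<nu> (T \<phi>) \<le> K * L2_norm \<nu> \<phi>)"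

definition L2_onorm ::
  "'x measure \<Rightarrow> (('x \<Rightarrow> 'h::complex_hilbert_space) \<Rightarrow> ('x \<Rightarrow> 'h)) \<Rightarrow> real" where
  "L2_onorm \<nu> T = (SUP \<phi>\<in>L2 \<nu>. L2_norm \<nu> (T \<phi>) / L2_norm \<nu> \<phi>)"

definition L2_supp ::
  "'x set \<Rightarrow> ('x \<Rightarrow> 'x \<Rightarrow> real) \<Rightarrow> 'x measure \<Rightarrow> ('x \<Rightarrow> 'h::complex_hilbert_space) \<Rightarrow> 'x set" where
  "L2_supp M d \<nu> \<phi> =
     {x \<in> M. \<forall>U. openin (Metric_space.mtopology M d) U \<and> x \<in> U
                   \<longrightarrow> \<not> (AE y in \<nu>. y \<in> U \<longrightarrow> \<phi> y = 0)}"

definition propagation_at_most ::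
  "'x set \<Rightarrow> ('x \<Rightarrow> 'x \<Rightarrow> real) \<Rightarrow> 'x measure \<Rightarrow> real \<Rightarrow>
     (('x \<Rightarrow> 'h::complex_hilbert_space) \<Rightarrow> ('x \<Rightarrow> 'h)) set" where
  "propagation_at_most M d \<nu> r =
     {T. L2_bounded_operator \<nu> T \<and>
         (\<forall>\<phi>\<in>L2 \<nu>. \<forall>\<psi>\<in>L2 \<nu>.
            set_distance d (L2_supp M d \<nu> \<phi>) (L2_supp M d \<nu> \<psi>) > ereal r
              \<longrightarrow> L2_inner \<nu> (T \<phi>) \<psi> = 0)}"

text \<open>The type argument is the auxiliary Hilbert space \<open>H\<close>.\<close>

definition operator_norm_localization ::
  "'h::{complex_hilbert_space, second_countable_topology} itself \<Rightarrow>
     'x set \<Rightarrow> ('x \<Rightarrow> 'x \<Rightarrow> real) \<Rightarrow> bool" where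
  "operator_norm_localization H M d \<longleftrightarrow>
     (\<exists>(c::real) (f::nat \<Rightarrow> nat). 0 < c \<and> c \<le> 1 \<and> mono f \<and>
       (\<forall>\<nu>. locally_finite_borel_measure M d \<nu> \<and> emeasure \<nu> M \<noteq> 0 \<longrightarrow>
         (\<forall>k. \<forall>T \<in> propagation_at_most M d \<nu> (real k).
           \<exists>\<phi>::'x \<Rightarrow> 'h. \<phi> \<in> L2 \<nu> \<and> \<not> (AE x in \<nu>. \<phi> x = 0) \<and>
             set_diameter d (L2_supp M d \<nu> \<phi>) \<le> ereal (real (f k)) \<and>
             L2_norm \<nu> (T \<phi>) \<ge> c * L2_onorm \<nu> T * L2_norm \<nu> \<phi>)))"

end

theory Submission
  imports Defs
begin

text \<open>Take \<open>\<nu>\<close> to be the counting measure on one large \<open>V\<^sub>n\<close> and \<open>T = (1 - \<Delta>/2D)\<^sup>k\<close> with the graph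
  Laplacian \<open>\<Delta>\<close>: its propagation is at most \<open>k\<close>, and \<open>\<parallel>T\<parallel> \<ge> 1\<close> since it fixes constants. If the support
  of \<open>\<phi>\<close> has diameter at most \<open>f(k)\<close>, then bounded degree bounds the cardinality of the supports of
  \<open>\<phi>\<close> and its first \<open>k\<close> iterates by a constant, hence by \<open>\<bar>V\<^sub>n\<bar>/2\<close> for large \<open>n\<close>. Cheeger's inequality for
  functions of small support, applied to the scalar function \<open>\<parallel>\<phi>\<parallel>\<close>, shows that every factor
  \<open>1 - \<Delta>/2D\<close> shrinks the squared norm by the fixed factor \<open>1 - h\<^sup>2/4D\<^sup>2\<close>. With \<open>k\<close> large this
  contradicts localization with constant \<open>c\<close>.\<close>

section \<open>Cheeger's inequality for small supports\<close>

text \<open>Models one finite graph by a symmetric adjacency matrix \<open>w\<close>, so that cuts,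
  degrees and the Laplacian all become double sums. \<open>expansion\<close> is the Cheeger bound
  for sets of at most half the vertices, for which the smaller side of the cut is \<open>S\<close>
  itself.\<close>

locale edge_expander =
  fixes W :: "'x set" and w :: "'x \<Rightarrow> 'x \<Rightarrow> real" and D h :: real
  assumes finite_W: "finite W"
    and w_nonneg: "0 \<le> w x y"
    and w_commute: "w x y = w y x"
    and degree_le: "x \<in> W \<Longrightarrow> (\<Sum>y\<in>W. w x y) \<le> D"
    and D_pos: "0 < D"
    and h_pos: "0 < h"
    and expansion: "S \<subseteq> W \<Longrightarrow> 2 * card S \<le> card W \<Longrightarrow> h * card S \<le> (\<Sum>x\<in>S. \<Sum>y\<in>W - S. w x y)"
begin

text \<open>The sum over ordered pairs meets every cut edge twice, once from each side. This is the
  origin of the factor 2 in the coarea inequality.\<close>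

lemma cut_weight:
  assumes "S \<subseteq> W"
  shows "(\<Sum>x\<in>W. \<Sum>y\<in>W. w x y * \<bar>indicator S x - indicator S y\<bar>) = 2 * (\<Sum>x\<in>S. \<Sum>y\<in>W - S. w x y)"
proof -
  have split: "(\<Sum>x\<in>W. f x) = (\<Sum>x\<in>S. f x) + (\<Sum>x\<in>W - S. f x)" for f :: "'x \<Rightarrow> real"
    by (metis assms finite_W sum.subset_diff add.commute)
  have "(\<Sum>x\<in>W. \<Sum>y\<in>W. w x y * \<bar>indicator S x - indicator S y\<bar>)
      = (\<Sum>x\<in>S. \<Sum>y\<in>W - S. w x y) + (\<Sum>x\<in>W - S. \<Sum>y\<in>S. w x y)"
    by (simp add: split)
  also have "(\<Sum>x\<in>W - S. \<Sum>y\<in>S. w x y) = (\<Sum>x\<in>S. \<Sum>y\<in>W - S. w x y)"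
    by (subst sum.swap) (simp add: w_commute)
  finally show ?thesis by simp
qed

text \<open>Expansion of a singleton, whose cut is at most its degree. It later makes the
  contraction factor nonnegative.\<close>

lemma h_le_D:
  assumes "x \<in> W" "2 \<le> card W"
  shows "h \<le> D"
proof -
  have "h \<le> (\<Sum>y\<in>W - {x}. w x y)" using expansion[of "{x}"] assms by simp
  also have "\<dots> \<le> (\<Sum>y\<in>W. w x y)" using finite_W w_nonneg by (intro sum_mono2) auto
  also have "\<dots> \<le> D" using degree_le assms by simp
  finally show ?thesis .
qed

text \<open>Peeling off the level sets of \<open>F\<close> one at a time reduces this to the expansion of sets.\<close>

lemma coarea_inequality:
  assumes "\<And>x. x \<in> W \<Longrightarrow> 0 \<le> F x" "2 * card {x \<in> W. 0 < F x} \<le> card W"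
  shows "2 * h * (\<Sum>x\<in>W. F x) \<le> (\<Sum>x\<in>W. \<Sum>y\<in>W. w x y * \<bar>F x - F y\<bar>)"
  using assms
proof (induction "card {x \<in> W. 0 < F x}" arbitrary: F rule: less_induct)
  case less
  define S where "S = {x \<in> W. 0 < F x}"
  have S: "S \<subseteq> W" "finite S" using finite_W by (auto simp: S_def)
  show ?case
  proof (cases "S = {}")
    case True
    then have "F x = 0" if "x \<in> W" for x
      using that less.prems(1)[OF that] by (force simp: S_def)
    then show ?thesis by simp
  next
    case False
    define m where "m = Min (F ` S)"
    have m_in: "m \<in> F ` S" and m_le: "\<And>x. x \<in> S \<Longrightarrow> m \<le> F x"
      using S False by (auto simp: m_def)
    have m_pos: "0 < m" using m_in by (auto simp: S_def)
    \<comment> \<open>\<open>G\<close> is \<open>F\<close> with its lowest positive level removed;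
      the minimizer \<open>x0\<close> leaves the support, so the induction applies.\<close>
    define G where "G x = F x - m * indicator S x" for x
    have zero: "F x = 0" if "x \<in> W" "x \<notin> S" for x
      using that less.prems(1)[of x] by (auto simp: S_def)
    have G_nonneg: "0 \<le> G x" if "x \<in> W" for x
      using m_le[of x] zero[of x] that by (cases "x \<in> S") (auto simp: G_def)
    obtain x0 where x0: "x0 \<in> S" "F x0 = m" using m_in by auto
    have "{x \<in> W. 0 < G x} \<subseteq> S - {x0}"
      using x0 zero by (auto simp: G_def S_def split: split_indicator)
    then have less_card: "card {x \<in> W. 0 < G x} < card S"
      using x0 S by (meson card_Diff1_less card_mono finite_Diff le_less_trans)
    have IH: "2 * h * (\<Sum>x\<in>W. G x) \<le> (\<Sum>x\<in>W. \<Sum>y\<in>W. w x y * \<bar>G x - G y\<bar>)"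
      using less.hyps[of G] less_card G_nonneg less.prems(2) by (simp add: S_def)
    \<comment> \<open>No cancellation occurs: the indicator term vanishes unless exactly one point
      lies in \<open>S\<close>, and then both differences have the same sign since \<open>G\<close>
      is nonnegative and vanishes on \<open>W - S\<close>.\<close>
    have abs_eq: "\<bar>F x - F y\<bar> = m * \<bar>indicator S x - indicator S y\<bar> + \<bar>G x - G y\<bar>"
      if "x \<in> W" "y \<in> W" for x y
      using m_le[of x] m_le[of y] zero[of x] zero[of y] that m_pos
      by (auto simp: G_def split: split_indicator)
    have "2 * h * (\<Sum>x\<in>W. F x) = m * (2 * (h * card S)) + 2 * h * (\<Sum>x\<in>W. G x)"
    proof -
      have "(\<Sum>x\<in>W. indicator S x) = real (card S)"
        using S finite_W by (simp add: sum.If_cases indicator_def Int_absorb1 Int_def[symmetric])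
      then show ?thesis
        by (simp add: G_def sum_subtractf flip: sum_distrib_left) (simp add: algebra_simps)
    qed
    also have "\<dots> \<le> m * (2 * (\<Sum>x\<in>S. \<Sum>y\<in>W - S. w x y))
        + (\<Sum>x\<in>W. \<Sum>y\<in>W. w x y * \<bar>G x - G y\<bar>)"
      using expansion[OF S(1)] less.prems(2) IH m_pos
      by (intro add_mono mult_left_mono) (auto simp: S_def)
    also have "\<dots> = (\<Sum>x\<in>W. \<Sum>y\<in>W. w x y * \<bar>F x - F y\<bar>)"
      unfolding cut_weight[OF S(1), symmetric]
      by (simp add: abs_eq sum_distrib_left sum.distrib[symmetric] algebra_simps cong: sum.cong)
    finally show ?thesis .
  qed
qed

lemma sum_degree_le:
  assumes "\<And>x. x \<in> W \<Longrightarrow> 0 \<le> F x"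
  shows "(\<Sum>x\<in>W. \<Sum>y\<in>W. w x y * F x) \<le> D * (\<Sum>x\<in>W. F x)"
    and "(\<Sum>x\<in>W. \<Sum>y\<in>W. w x y * F y) \<le> D * (\<Sum>x\<in>W. F x)"
proof -
  show *: "(\<Sum>x\<in>W. \<Sum>y\<in>W. w x y * F x) \<le> D * (\<Sum>x\<in>W. F x)"
    unfolding sum_distrib_left
    by (intro sum_mono) (simp add: sum_distrib_right[symmetric] mult_right_mono degree_le assms)
  have "(\<Sum>x\<in>W. \<Sum>y\<in>W. w x y * F y) = (\<Sum>x\<in>W. \<Sum>y\<in>W. w x y * F x)"
    by (subst sum.swap) (simp add: w_commute)
  with * show "(\<Sum>x\<in>W. \<Sum>y\<in>W. w x y * F y) \<le> D * (\<Sum>x\<in>W. F x)" by simp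
qed

text \<open>Cheeger's argument: the coarea inequality is applied to the square of \<open>g\<close>,
  whose differences factor into \<open>g x - g y\<close> and \<open>g x + g y\<close>. The first
  factor yields the Dirichlet energy; the second is controlled by the degree bound and absorbed on
  the left.\<close>

lemma energy_bound:
  assumes nonneg: "\<And>x. x \<in> W \<Longrightarrow> 0 \<le> g x" and small: "2 * card {x \<in> W. 0 < g x} \<le> card W"
  shows "h\<^sup>2 * (\<Sum>x\<in>W. (g x)\<^sup>2) \<le> D * (\<Sum>x\<in>W. \<Sum>y\<in>W. w x y * (g x - g y)\<^sup>2)"
proof -
  define G where "G = (\<Sum>x\<in>W. (g x)\<^sup>2)"
  define Q where "Q = (\<Sum>x\<in>W. \<Sum>y\<in>W. w x y * (g x - g y)\<^sup>2)"
  have "{x \<in> W. 0 < (g x)\<^sup>2} = {x \<in> W. 0 < g x}" using nonneg by force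
  then have "2 * h * G \<le> (\<Sum>x\<in>W. \<Sum>y\<in>W. w x y * \<bar>(g x)\<^sup>2 - (g y)\<^sup>2\<bar>)"
    unfolding G_def using coarea_inequality[of "\<lambda>x. (g x)\<^sup>2"] small by simp
  \<comment> \<open>AM-GM with the weight that balances the two resulting terms\<close>
  also have "\<dots> \<le> (\<Sum>x\<in>W. \<Sum>y\<in>W. w x y * (D / h * (g x - g y)\<^sup>2
      + h / (2 * D) * ((g x)\<^sup>2 + (g y)\<^sup>2)))"
  proof (intro sum_mono mult_left_mono w_nonneg)
    fix x y
    define a b where "a = g x - g y" and "b = g x + g y"
    have "\<bar>(g x)\<^sup>2 - (g y)\<^sup>2\<bar> = \<bar>a\<bar> * \<bar>b\<bar>"
      by (simp add: a_def b_def abs_mult[symmetric] power2_eq_square algebra_simps)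
    also have "\<dots> \<le> D / h * a\<^sup>2 + h / (4 * D) * b\<^sup>2"
    proof -
      \<comment> \<open>Expanding this square and dividing by \<open>4 * D * h\<close> gives exactly
        the weights \<open>D / h\<close> and \<open>h / (4 * D)\<close>.\<close>
      have "0 \<le> (2 * D * \<bar>a\<bar> - h * \<bar>b\<bar>)\<^sup>2" by simp
      then have "4 * D * h * (\<bar>a\<bar> * \<bar>b\<bar>) \<le> 4 * D\<^sup>2 * a\<^sup>2 + h\<^sup>2 * b\<^sup>2"
        by (simp add: power2_diff power_mult_distrib algebra_simps)
      then show ?thesis using D_pos h_pos by (simp add: field_simps power2_eq_square)
    qed
    also have "h / (4 * D) * b\<^sup>2 \<le> h / (4 * D) * (2 * ((g x)\<^sup>2 + (g y)\<^sup>2))"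
      using D_pos h_pos sum_squares_bound[of "g x" "g y"]
      by (intro mult_left_mono) (auto simp: b_def power2_sum)
    also have "\<dots> = h / (2 * D) * ((g x)\<^sup>2 + (g y)\<^sup>2)"
      using D_pos by (simp add: field_simps)
    finally show "\<bar>(g x)\<^sup>2 - (g y)\<^sup>2\<bar> \<le> D / h * (g x - g y)\<^sup>2 + h / (2 * D) * ((g x)\<^sup>2 + (g y)\<^sup>2)"
      by (simp add: a_def)
  qed
  also have "\<dots> = D / h * Q + h / (2 * D) *
      ((\<Sum>x\<in>W. \<Sum>y\<in>W. w x y * (g x)\<^sup>2) + (\<Sum>x\<in>W. \<Sum>y\<in>W. w x y * (g y)\<^sup>2))"
    by (simp add: Q_def distrib_left sum.distrib sum_distrib_left mult.left_commute)
  also have "\<dots> \<le> D / h * Q + h / (2 * D) * (D * G + D * G)"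
    unfolding G_def using D_pos h_pos
    by (intro add_left_mono mult_left_mono add_mono sum_degree_le) auto
  also have "\<dots> = D / h * Q + h * G" using D_pos by (simp add: field_simps)
  \<comment> \<open>The term \<open>h * G\<close> on the right is half of \<open>2 * h * G\<close>
    on the left, so subtracting it leaves only the energy.\<close>
  finally have "h * G \<le> D / h * Q" by (simp add: mult.commute)
  from mult_left_mono[OF this, of h] show ?thesis
    unfolding G_def[symmetric] Q_def[symmetric] using h_pos by (simp add: power2_eq_square)
qed

section \<open>The lazy random walk and its contraction\<close>

text \<open>This is 1 - Laplacian/(2D). It is polymorphic in the values because it acts both on
  Hilbert-space-valued functions and on their pointwise norms. The value 0 off \<open>W\<close> lets
  functions extended by zero be genuine fixed points.\<close>

definition walk :: "('x \<Rightarrow> 'v::real_vector) \<Rightarrow> 'x \<Rightarrow> 'v" where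
  "walk \<phi> x = (if x \<in> W then \<phi> x - (1 / (2 * D)) *\<^sub>R (\<Sum>y\<in>W. w x y *\<^sub>R (\<phi> x - \<phi> y)) else 0)"

lemma walk_add: "walk (\<lambda>x. \<phi> x + \<psi> x) = (\<lambda>x. walk \<phi> x + walk \<psi> x)"
  by (auto simp: walk_def fun_eq_iff algebra_simps sum.distrib sum_subtractf)

lemma walk_const: "x \<in> W \<Longrightarrow> walk (\<lambda>x. if x \<in> W then v else 0) x = v"
  by (simp add: walk_def)

text \<open>The walk averages with nonnegative coefficients, so the triangle inequality reduces
  vector-valued estimates to the scalar function of norms.\<close>

lemma norm_walk_le:
  fixes \<phi> :: "'x \<Rightarrow> 'v::real_normed_vector"
  shows "norm (walk \<phi> x) \<le> walk (\<lambda>y. norm (\<phi> y)) x"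
proof (cases "x \<in> W")
  case True
  \<comment> \<open>The weight that stays at \<open>x\<close>; the factor 2 in \<open>2 * D\<close>
    keeps it at least 1/2.\<close>
  define s where "s = 1 - (1 / (2 * D)) * (\<Sum>y\<in>W. w x y)"
  have eq: "walk f x = s *\<^sub>R f x + (1 / (2 * D)) *\<^sub>R (\<Sum>y\<in>W. w x y *\<^sub>R f y)"
    for f :: "'x \<Rightarrow> 'u::real_vector"
    using True by (simp add: walk_def s_def scaleR_diff_right sum_subtractf algebra_simps flip: scaleR_sum_left)
  have "0 \<le> s" using degree_le[OF True] D_pos by (simp add: s_def field_simps)
  then have "norm (walk \<phi> x) \<le> s * norm (\<phi> x) + (1 / (2 * D)) * norm (\<Sum>y\<in>W. w x y *\<^sub>R \<phi> y)"
    unfolding eq using D_pos by (intro order_trans[OF norm_triangle_ineq]) simp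
  also have "norm (\<Sum>y\<in>W. w x y *\<^sub>R \<phi> y) \<le> (\<Sum>y\<in>W. w x y * norm (\<phi> y))"
    by (intro order_trans[OF norm_sum] sum_mono) (simp add: w_nonneg)
  finally show ?thesis unfolding eq using D_pos by (simp add: divide_right_mono)
qed (simp add: walk_def)

text \<open>Expand the square of \<open>g x - L x / (2 * D)\<close>, where \<open>L\<close> is the
  Laplacian of \<open>g\<close>. The cross term contributes \<open>- Q / (2 * D)\<close> and the
  square of \<open>L\<close> at most \<open>Q / (4 * D)\<close>.\<close>

lemma sum_walk_square_le:
  fixes g :: "'x \<Rightarrow> real"
  shows "(\<Sum>x\<in>W. (walk g x)\<^sup>2)
    \<le> (\<Sum>x\<in>W. (g x)\<^sup>2) - (\<Sum>x\<in>W. \<Sum>y\<in>W. w x y * (g x - g y)\<^sup>2) / (4 * D)"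
proof -
  define Q where "Q = (\<Sum>x\<in>W. \<Sum>y\<in>W. w x y * (g x - g y)\<^sup>2)"
  define L where "L x = (\<Sum>y\<in>W. w x y * (g x - g y))" for x
  \<comment> \<open>Summation by parts: exchange \<open>x\<close> and \<open>y\<close> by symmetry
    of \<open>w\<close> and add the two forms.\<close>
  have gL: "2 * (\<Sum>x\<in>W. g x * L x) = Q"
  proof -
    have "(\<Sum>x\<in>W. g x * L x) = (\<Sum>x\<in>W. \<Sum>y\<in>W. w x y * (g x * (g x - g y)))"
      by (simp add: L_def sum_distrib_left algebra_simps)
    moreover have "(\<Sum>x\<in>W. g x * L x) = (\<Sum>x\<in>W. \<Sum>y\<in>W. w x y * (g y * (g y - g x)))"
      unfolding calculation by (subst sum.swap) (simp add: w_commute)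
    ultimately have "2 * (\<Sum>x\<in>W. g x * L x) =
        (\<Sum>x\<in>W. \<Sum>y\<in>W. w x y * (g x * (g x - g y)) + w x y * (g y * (g y - g x)))"
      by (simp add: sum.distrib)
    also have "\<dots> = Q"
      unfolding Q_def by (intro sum.cong) (auto simp: power2_eq_square algebra_simps)
    finally show ?thesis .
  qed
  have "(L x)\<^sup>2 \<le> D * (\<Sum>y\<in>W. w x y * (g x - g y)\<^sup>2)" if "x \<in> W" for x
  proof -
    \<comment> \<open>Splitting the weight into two square roots lets Cauchy-Schwarz produce the
      degree times the local energy.\<close>
    have "(L x)\<^sup>2 = (\<Sum>y\<in>W. sqrt (w x y) * (sqrt (w x y) * (g x - g y)))\<^sup>2"
      by (simp add: L_def w_nonneg flip: mult.assoc)
    also have "\<dots> \<le> (\<Sum>y\<in>W. (sqrt (w x y))\<^sup>2) * (\<Sum>y\<in>W. (sqrt (w x y) * (g x - g y))\<^sup>2)"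
      by (rule Cauchy_Schwarz_ineq_sum)
    also have "\<dots> = (\<Sum>y\<in>W. w x y) * (\<Sum>y\<in>W. w x y * (g x - g y)\<^sup>2)"
      by (simp add: w_nonneg power_mult_distrib)
    also have "\<dots> \<le> D * (\<Sum>y\<in>W. w x y * (g x - g y)\<^sup>2)"
      by (intro mult_right_mono degree_le that sum_nonneg mult_nonneg_nonneg w_nonneg) simp
    finally show ?thesis .
  qed
  then have LL: "(\<Sum>x\<in>W. (L x)\<^sup>2) \<le> D * Q"
    unfolding Q_def sum_distrib_left[of D] by (rule sum_mono)
  have "(\<Sum>x\<in>W. (walk g x)\<^sup>2) = (\<Sum>x\<in>W. (g x)\<^sup>2 - (1 / D) * (g x * L x) + (1 / (4 * D\<^sup>2)) * (L x)\<^sup>2)"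
    by (intro sum.cong) (auto simp: walk_def L_def[symmetric] power2_diff power_divide power_mult_distrib)
  also have "\<dots> = (\<Sum>x\<in>W. (g x)\<^sup>2) - (1 / (2 * D)) * (2 * (\<Sum>x\<in>W. g x * L x))
      + (1 / (4 * D\<^sup>2)) * (\<Sum>x\<in>W. (L x)\<^sup>2)"
    by (simp only: sum.distrib sum_subtractf sum_distrib_left[symmetric])
  also have "\<dots> \<le> (\<Sum>x\<in>W. (g x)\<^sup>2) - (1 / (2 * D)) * Q + (1 / (4 * D\<^sup>2)) * (D * Q)"
    unfolding gL using LL by (intro add_left_mono mult_left_mono) auto
  also have "\<dots> = (\<Sum>x\<in>W. (g x)\<^sup>2) - Q / (4 * D)"
    using D_pos by (simp add: field_simps power2_eq_square)
  finally show ?thesis unfolding Q_def .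
qed

lemma walk_norm_le:
  fixes \<phi> :: "'x \<Rightarrow> 'v::real_normed_vector"
  shows "(\<Sum>x\<in>W. (norm (walk \<phi> x))\<^sup>2) \<le> (\<Sum>x\<in>W. (norm (\<phi> x))\<^sup>2)"
proof -
  have "(\<Sum>x\<in>W. (norm (walk \<phi> x))\<^sup>2) \<le> (\<Sum>x\<in>W. (walk (\<lambda>y. norm (\<phi> y)) x)\<^sup>2)"
    by (intro sum_mono power_mono norm_walk_le) auto
  also have "\<dots> \<le> (\<Sum>x\<in>W. (norm (\<phi> x))\<^sup>2) - (\<Sum>x\<in>W. \<Sum>y\<in>W. w x y * (norm (\<phi> x) - norm (\<phi> y))\<^sup>2) / (4 * D)"
    by (rule sum_walk_square_le)
  also have "\<dots> \<le> (\<Sum>x\<in>W. (norm (\<phi> x))\<^sup>2)"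
    using D_pos by (simp add: sum_nonneg w_nonneg)
  finally show ?thesis .
qed

text \<open>The energy lost in one step is a fixed fraction of the squared norm by Cheeger's
  inequality, applied to the pointwise norm of \<open>\<phi>\<close>, which has the same
  support.\<close>

lemma walk_norm_contract:
  fixes \<phi> :: "'x \<Rightarrow> 'v::real_normed_vector"
  assumes "2 * card {x \<in> W. \<phi> x \<noteq> 0} \<le> card W"
  shows "(\<Sum>x\<in>W. (norm (walk \<phi> x))\<^sup>2) \<le> (1 - h\<^sup>2 / (4 * D\<^sup>2)) * (\<Sum>x\<in>W. (norm (\<phi> x))\<^sup>2)"
proof -
  define G Q where "G = (\<Sum>x\<in>W. (norm (\<phi> x))\<^sup>2)"
    and "Q = (\<Sum>x\<in>W. \<Sum>y\<in>W. w x y * (norm (\<phi> x) - norm (\<phi> y))\<^sup>2)"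
  have "(\<Sum>x\<in>W. (norm (walk \<phi> x))\<^sup>2) \<le> (\<Sum>x\<in>W. (walk (\<lambda>y. norm (\<phi> y)) x)\<^sup>2)"
    by (intro sum_mono power_mono norm_walk_le) auto
  also have "\<dots> \<le> G - Q / (4 * D)"
    unfolding G_def Q_def by (rule sum_walk_square_le)
  also have "\<dots> \<le> (1 - h\<^sup>2 / (4 * D\<^sup>2)) * G"
  proof -
    have "h\<^sup>2 * G \<le> D * Q"
      unfolding G_def Q_def using energy_bound[of "\<lambda>x. norm (\<phi> x)"] assms by simp
    then show ?thesis using D_pos by (simp add: field_simps power2_eq_square)
  qed
  finally show ?thesis unfolding G_def .
qed

text \<open>One step enlarges the support by neighbours only; this is the source of finite
  propagation.\<close>

lemma walk_nonzeroD:
  assumes "walk \<phi> x \<noteq> 0"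
  obtains "x \<in> W" "\<phi> x \<noteq> 0" | y where "x \<in> W" "y \<in> W" "\<phi> y \<noteq> 0" "w x y \<noteq> 0"
proof (cases "\<phi> x = 0")
  case True
  have "\<exists>y\<in>W. \<phi> y \<noteq> 0 \<and> w x y \<noteq> 0"
  proof (rule ccontr)
    assume "\<not> ?thesis"
    then have "(\<Sum>y\<in>W. w x y *\<^sub>R (\<phi> x - \<phi> y)) = 0"
      using True by (intro sum.neutral) auto
    with True assms show False by (auto simp: walk_def split: if_splits)
  qed
  with assms that(2) show ?thesis by (auto simp: walk_def split: if_splits)
qed (use assms that(1) in \<open>auto simp: walk_def split: if_splits\<close>)

end

section \<open>Operators over finite counting measures\<close>

text \<open>Localization quantifies over measures whose space is the whole metric space, so the
  counting measure of \<open>W\<close> is written as a density on \<open>M\<close> that vanishes off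
  \<open>W\<close>.\<close>

definition counting_on :: "'x set \<Rightarrow> 'x set \<Rightarrow> 'x measure" where
  "counting_on M W = density (count_space M) (\<lambda>x. ennreal (indicator W x))"

lemma space_counting_on [simp]: "space (counting_on M W) = M"
  and sets_counting_on [simp]: "sets (counting_on M W) = Pow M"
  by (simp_all add: counting_on_def)

lemma borel_measurable_counting_on [simp]: "f \<in> borel_measurable (counting_on M W)"
  by (simp add: counting_on_def)

lemma AE_counting_on: "W \<subseteq> M \<Longrightarrow> (AE x in counting_on M W. P x) \<longleftrightarrow> (\<forall>x\<in>W. P x)"
  unfolding counting_on_def
  by (subst AE_density) (auto simp: AE_count_space indicator_def split: if_splits)

lemma emeasure_counting_on:
  assumes "finite W" "W \<subseteq> M" "S \<subseteq> M"
  shows "emeasure (counting_on M W) S = of_nat (card (W \<inter> S))"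
proof -
  have "emeasure (counting_on M W) S = (\<integral>\<^sup>+x. ennreal (indicator W x) * indicator S x \<partial>count_space M)"
    unfolding counting_on_def using assms by (subst emeasure_density) auto
  also have "\<dots> = (\<integral>\<^sup>+x. indicator (W \<inter> S) x \<partial>count_space M)"
    by (intro nn_integral_cong) (auto split: split_indicator)
  also have "\<dots> = emeasure (count_space M) (W \<inter> S)"
    using assms by (intro nn_integral_indicator) auto
  also have "\<dots> = of_nat (card (W \<inter> S))"
    using assms by (subst emeasure_count_space_finite) (auto intro: finite_subset)
  finally show ?thesis .
qed

lemma integrable_counting_on:
  fixes f :: "'x \<Rightarrow> 'v::{banach, second_countable_topology}"
  assumes "finite W" "W \<subseteq> M"
  shows "integrable (counting_on M W) f"
proof -
  have "(\<integral>\<^sup>+x. ennreal (norm (indicator W x *\<^sub>R f x)) \<partial>count_space M)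
      = (\<Sum>x\<in>W. ennreal (norm (indicator W x *\<^sub>R f x)))"
    using assms by (intro nn_integral_count_space') auto
  then have "integrable (count_space M) (\<lambda>x. indicator W x *\<^sub>R f x)"
    by (simp add: integrable_iff_bounded)
  then show ?thesis
    by (simp add: counting_on_def integrable_density)
qed

lemma integral_counting_on:
  fixes f :: "'x \<Rightarrow> 'v::{banach, second_countable_topology}"
  assumes "finite W" "W \<subseteq> M"
  shows "(LINT x|counting_on M W. f x) = (\<Sum>x\<in>W. f x)"
proof -
  have sub: "{x \<in> M. indicat_real W x *\<^sub>R f x \<noteq> 0} \<subseteq> W" by (auto split: split_indicator_asm)
  have "(LINT x|counting_on M W. f x) = (LINT x|count_space M. indicat_real W x *\<^sub>R f x)"
    by (simp add: counting_on_def integral_density)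
  also have "\<dots> = (\<Sum>x | x \<in> M \<and> indicat_real W x *\<^sub>R f x \<noteq> 0. indicat_real W x *\<^sub>R f x)"
    using finite_subset[OF sub assms(1)] by (rule lebesgue_integral_count_space_finite_support)
  also have "\<dots> = (\<Sum>x\<in>W. indicat_real W x *\<^sub>R f x)"
    using assms sub by (intro sum.mono_neutral_left) auto
  also have "\<dots> = (\<Sum>x\<in>W. f x)" by simp
  finally show ?thesis .
qed

section \<open>Algebra of the complex Hilbert space\<close>

lemma scaleC_zero_right [simp]: "scaleC a (0 :: 'h::complex_hilbert_space) = 0"
  using scaleC_add_right[of a "0::'h" 0] by simp

lemma scaleC_minus_right: "scaleC a (- x :: 'h::complex_hilbert_space) = - scaleC a x"
  using scaleC_add_right[of a x "- x"] by (simp add: eq_neg_iff_add_eq_0 add.commute)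

lemma scaleC_diff_right: "scaleC a (x - y :: 'h::complex_hilbert_space) = scaleC a x - scaleC a y"
  using scaleC_add_right[of a x "- y"] by (simp add: scaleC_minus_right)

lemma scaleC_scaleR: "scaleC a (r *\<^sub>R x :: 'h::complex_hilbert_space) = r *\<^sub>R scaleC a x"
  by (metis mult.commute scaleC_of_real scaleC_scaleC)

lemma scaleC_sum_right: "scaleC a (\<Sum>x\<in>S. f x :: 'h::complex_hilbert_space) = (\<Sum>x\<in>S. scaleC a (f x))"
  by (induction S rule: infinite_finite_induct) (auto simp: scaleC_add_right)

lemma cinner_zero_left [simp]: "cinner (0 :: 'h::complex_hilbert_space) x = 0"
  using cinner_add_left[of "0::'h" 0 x] by simp

lemma cinner_zero_right [simp]: "cinner x (0 :: 'h::complex_hilbert_space) = 0"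
  by (subst cinner_commute) simp

lemma module_scaleC: "module (scaleC :: complex \<Rightarrow> 'h \<Rightarrow> 'h::complex_hilbert_space)"
  by unfold_locales (simp_all add: scaleC_add_right scaleC_add_left scaleC_scaleC scaleC_one)

text \<open>Otherwise the empty set would span. The vector is the value of the constant test
  function that bounds the operator norm from below.\<close>

lemma ex_nonzero_vector:
  assumes "\<nexists>B :: 'h::complex_hilbert_space set. finite B \<and> module.span scaleC B = UNIV"
  shows "\<exists>v :: 'h. v \<noteq> 0"
proof (rule ccontr)
  assume "\<not> ?thesis"
  then have "module.span scaleC {} = (UNIV :: 'h set)"
    by (auto simp: module.span_empty[OF module_scaleC])
  with assms show False by blast
qed

section \<open>The walk as an operator of finite propagation\<close>

text \<open>Places the expander inside a larger discrete space. Discreteness makes all subsets Borel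
  and supports pointwise; \<open>dist_le_1\<close> makes one walk step have propagation at most
  1.\<close>

locale metric_expander = edge_expander W w D h + Metric_space M d
  for W :: "'x set" and w D h and M :: "'x set" and d +
  assumes W_subset: "W \<subseteq> M"
    and W_nonempty: "W \<noteq> {}"
    and discrete: "x \<in> M \<Longrightarrow> openin mtopology {x}"
    and dist_le_1: "x \<in> W \<Longrightarrow> y \<in> W \<Longrightarrow> w x y \<noteq> 0 \<Longrightarrow> d x y \<le> 1"
begin

abbreviation "\<nu> \<equiv> counting_on M W"

lemma locally_finite_counting_on: "locally_finite_borel_measure M d \<nu>"
proof -
  have open_any: "openin mtopology U" if "U \<subseteq> M" for U
  proof -
    have "openin mtopology (\<Union>x\<in>U. {x})"
      using that discrete by (intro openin_Union) auto
    then show ?thesis by simp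
  qed
  have "{U. openin mtopology U} = Pow M"
    using open_any openin_subset[of mtopology] by auto
  moreover have "sigma_sets M (Pow M) = Pow M"
    using sigma_sets_into_sp[of "Pow M" M] by (auto intro: sigma_sets.Basic)
  ultimately show ?thesis
    using finite_W W_subset
    by (simp add: locally_finite_borel_measure_def emeasure_counting_on of_nat_less_top)
qed

lemma emeasure_counting_on_nonzero: "emeasure \<nu> M \<noteq> 0"
  using finite_W W_subset W_nonempty by (simp add: emeasure_counting_on Int_absorb2)

lemma L2_counting_on [simp]: "\<phi> \<in> L2 \<nu>"
  using finite_W W_subset by (simp add: L2_def integrable_counting_on)

lemma L2_norm_counting_on: "L2_norm \<nu> \<phi> = sqrt (\<Sum>x\<in>W. (norm (\<phi> x))\<^sup>2)"
  using finite_W W_subset by (simp add: L2_norm_def integral_counting_on)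

lemma L2_inner_counting_on: "L2_inner \<nu> \<phi> \<psi> = (\<Sum>x\<in>W. cinner (\<phi> x) (\<psi> x))"
  using finite_W W_subset by (simp add: L2_inner_def integral_counting_on)

text \<open>The open neighbourhood \<open>{x}\<close> alone decides whether \<open>x\<close> lies in
  the support.\<close>

lemma L2_supp_counting_on: "L2_supp M d \<nu> \<phi> = {x \<in> W. \<phi> x \<noteq> 0}"
proof -
  have "x \<in> L2_supp M d \<nu> \<phi> \<longleftrightarrow> x \<in> W \<and> \<phi> x \<noteq> 0" for x
    using W_subset discrete[of x] unfolding L2_supp_def by (auto simp: AE_counting_on)
  then show ?thesis by auto
qed

lemma walk_scaleC:
  fixes \<phi> :: "'x \<Rightarrow> 'h::complex_hilbert_space"
  shows "walk (\<lambda>x. scaleC a (\<phi> x)) = (\<lambda>x. scaleC a (walk \<phi> x))"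
  by (auto simp: walk_def fun_eq_iff scaleC_diff_right scaleC_scaleR scaleC_sum_right)

lemma funpow_walk_add:
  "(walk ^^ k) (\<lambda>x. \<phi> x + \<psi> x) = (\<lambda>x. (walk ^^ k) \<phi> x + (walk ^^ k) \<psi> x)"
  by (induction k) (simp_all add: walk_add)

lemma funpow_walk_scaleC:
  fixes \<phi> :: "'x \<Rightarrow> 'h::complex_hilbert_space"
  shows "(walk ^^ k) (\<lambda>x. scaleC a (\<phi> x)) = (\<lambda>x. scaleC a ((walk ^^ k) \<phi> x))"
  by (induction k) (simp_all add: walk_scaleC)

lemma L2_norm_funpow_walk_le: "L2_norm \<nu> ((walk ^^ k) \<phi>) \<le> L2_norm \<nu> \<phi>"
proof (induction k)
  case (Suc k)
  have "L2_norm \<nu> ((walk ^^ Suc k) \<phi>) \<le> L2_norm \<nu> ((walk ^^ k) \<phi>)"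
    by (simp add: L2_norm_counting_on walk_norm_le)
  with Suc show ?case by simp
qed simp

lemma L2_bounded_operator_walk:
  "L2_bounded_operator \<nu> (walk ^^ k :: ('x \<Rightarrow> 'h::complex_hilbert_space) \<Rightarrow> _)"
  unfolding L2_bounded_operator_def
  by (auto simp: funpow_walk_add funpow_walk_scaleC L2_norm_funpow_walk_le intro!: exI[of _ 1])

text \<open>Trace the value at \<open>x\<close> back step by step; each step stays put or moves to a
  neighbour, and the triangle inequality adds up the distances.\<close>

lemma funpow_walk_nonzeroD:
  assumes "(walk ^^ k) \<phi> x \<noteq> 0" "x \<in> W"
  shows "\<exists>y\<in>W. \<phi> y \<noteq> 0 \<and> d x y \<le> k"
  using assms
proof (induction k arbitrary: x)
  case 0
  then show ?case using W_subset zero[of x x] by (intro bexI[of _ x]) auto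
next
  case (Suc k)
  from Suc.prems(1) have "walk ((walk ^^ k) \<phi>) x \<noteq> 0" by simp
  then obtain z where z: "z \<in> W" "(walk ^^ k) \<phi> z \<noteq> 0" "d x z \<le> 1"
  proof (cases rule: walk_nonzeroD)
    case 1
    then show ?thesis using that[of x] zero[of x x] W_subset by auto
  next
    case (2 y)
    then show ?thesis using that[of y] dist_le_1 by auto
  qed
  from Suc.IH[OF z(2,1)] obtain y where y: "y \<in> W" "\<phi> y \<noteq> 0" "d z y \<le> k" by auto
  have "d x y \<le> Suc k"
    using triangle[of x z y] z y Suc.prems(2) subsetD[OF W_subset] by fastforce
  with y show ?case by blast
qed

text \<open>A nonzero summand of the inner product at \<open>x\<close> traces back to a point of the
  support of \<open>\<phi>\<close> within distance \<open>k\<close>, so the two supports cannot be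
  farther apart.\<close>

lemma walk_propagation:
  "(walk ^^ k :: ('x \<Rightarrow> 'h::complex_hilbert_space) \<Rightarrow> _) \<in> propagation_at_most M d \<nu> (real k)"
proof -
  have "L2_inner \<nu> ((walk ^^ k) \<phi>) \<psi> = 0"
    if far: "ereal (real k) < set_distance d {x \<in> W. \<phi> x \<noteq> 0} {x \<in> W. \<psi> x \<noteq> 0}"
    for \<phi> \<psi> :: "'x \<Rightarrow> 'h"
    unfolding L2_inner_counting_on
  proof (rule sum.neutral, rule ballI, rule ccontr)
    fix x assume x: "x \<in> W" and "cinner ((walk ^^ k) \<phi> x) (\<psi> x) \<noteq> 0"
    then have nz: "(walk ^^ k) \<phi> x \<noteq> 0" "\<psi> x \<noteq> 0" by auto
    from funpow_walk_nonzeroD[OF nz(1) x] obtain y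
      where y: "y \<in> W" "\<phi> y \<noteq> 0" "d x y \<le> k" by auto
    have "set_distance d {x \<in> W. \<phi> x \<noteq> 0} {x \<in> W. \<psi> x \<noteq> 0} \<le> ereal (d y x)"
      unfolding set_distance_def using x y nz by (intro INF_lower2[of y] INF_lower2[of x]) auto
    also have "\<dots> \<le> ereal (real k)" using y(3) by (simp add: commute)
    finally show False using far by simp
  qed
  then show ?thesis
    by (simp add: propagation_at_most_def L2_bounded_operator_walk L2_supp_counting_on)
qed

text \<open>The constant function with value \<open>v\<close> on \<open>W\<close> is fixed by the
  walk.\<close>

lemma L2_onorm_walk_ge_1:
  assumes "v \<noteq> (0 :: 'h::complex_hilbert_space)"
  shows "1 \<le> L2_onorm \<nu> (walk ^^ k :: ('x \<Rightarrow> 'h) \<Rightarrow> _)"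
proof -
  define \<phi> where "\<phi> x = (if x \<in> W then v else 0)" for x
  have "walk \<phi> = \<phi>"
    using walk_const[of _ v] by (auto simp: fun_eq_iff \<phi>_def walk_def)
  then have fixed: "(walk ^^ k) \<phi> = \<phi>" by (induction k) auto
  have "0 < (\<Sum>x\<in>W. (norm (\<phi> x))\<^sup>2)"
    using assms finite_W W_nonempty by (intro sum_pos) (auto simp: \<phi>_def)
  then have "1 = L2_norm \<nu> ((walk ^^ k) \<phi>) / L2_norm \<nu> \<phi>"
    by (simp add: fixed L2_norm_counting_on)
  also have "\<dots> \<le> L2_onorm \<nu> (walk ^^ k :: ('x \<Rightarrow> 'h) \<Rightarrow> _)"
    unfolding L2_onorm_def
  proof (rule cSUP_upper)
    show "bdd_above ((\<lambda>\<phi> :: 'x \<Rightarrow> 'h. L2_norm \<nu> ((walk ^^ k) \<phi>) / L2_norm \<nu> \<phi>) ` L2 \<nu>)"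
    proof (intro bdd_aboveI[of _ 1], clarify)
      fix \<psi> :: "'x \<Rightarrow> 'h"
      have "0 \<le> L2_norm \<nu> \<psi>" by (simp add: L2_norm_counting_on sum_nonneg)
      \<comment> \<open>For \<open>\<psi>\<close> of norm 0 the quotient is 0 by the convention on
        division by zero.\<close>
      then show "L2_norm \<nu> ((walk ^^ k) \<psi>) / L2_norm \<nu> \<psi> \<le> 1"
        using L2_norm_funpow_walk_le[of k \<psi>] by (auto simp: divide_le_eq_1)
    qed
  qed simp
  finally show ?thesis .
qed

text \<open>Before each of the \<open>k\<close> steps the support lies in a ball of radius less than
  \<open>R + k\<close> plus, at most, equality; that ball holds at most half of \<open>W\<close>, so
  every step contracts.\<close>

lemma L2_norm_funpow_walk_small_support:
  fixes \<phi> :: "'x \<Rightarrow> 'h::complex_hilbert_space"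
  assumes supp: "\<And>x. x \<in> W \<Longrightarrow> \<phi> x \<noteq> 0 \<Longrightarrow> d x0 x \<le> R" and "0 \<le> R"
    and x0: "x0 \<in> W"
    and small: "2 * card {x \<in> W. d x0 x \<le> R + k} \<le> card W"
  shows "(L2_norm \<nu> ((walk ^^ k) \<phi>))\<^sup>2 \<le> (1 - h\<^sup>2 / (4 * D\<^sup>2)) ^ k * (L2_norm \<nu> \<phi>)\<^sup>2"
  using small
proof (induction k)
  case (Suc k)
  have "{x \<in> W. (walk ^^ k) \<phi> x \<noteq> 0} \<subseteq> {x \<in> W. d x0 x \<le> R + real k}"
  proof safe
    fix x assume x: "x \<in> W" "(walk ^^ k) \<phi> x \<noteq> 0"
    then obtain y where y: "y \<in> W" "\<phi> y \<noteq> 0" "d x y \<le> k" using funpow_walk_nonzeroD by blast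
    show "d x0 x \<le> R + k"
      using triangle[of x0 y x] supp[OF y(1,2)] y x x0 subsetD[OF W_subset] commute[of x y] by fastforce
  qed
  moreover have "{x \<in> W. d x0 x \<le> R + real k} \<subseteq> {x \<in> W. d x0 x \<le> R + real (Suc k)}" by auto
  ultimately have "card {x \<in> W. (walk ^^ k) \<phi> x \<noteq> 0} \<le> card {x \<in> W. d x0 x \<le> R + real k}"
    "card {x \<in> W. d x0 x \<le> R + real k} \<le> card {x \<in> W. d x0 x \<le> R + real (Suc k)}"
    using finite_W by (auto intro!: card_mono)
  then have small_k: "2 * card {x \<in> W. (walk ^^ k) \<phi> x \<noteq> 0} \<le> card W"
    "2 * card {x \<in> W. d x0 x \<le> R + real k} \<le> card W"
    using Suc.prems by linarith+
  define q where "q = 1 - h\<^sup>2 / (4 * D\<^sup>2)"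
  have IH: "(L2_norm \<nu> ((walk ^^ k) \<phi>))\<^sup>2 \<le> q ^ k * (L2_norm \<nu> \<phi>)\<^sup>2"
    using Suc.IH small_k by (simp add: q_def)
  have step: "(L2_norm \<nu> ((walk ^^ Suc k) \<phi>))\<^sup>2 \<le> q * (L2_norm \<nu> ((walk ^^ k) \<phi>))\<^sup>2"
    using walk_norm_contract[OF small_k(1)]
    by (simp add: L2_norm_counting_on sum_nonneg q_def)
  \<comment> \<open>A nonempty ball filling at most half of \<open>W\<close> forces two points in
    \<open>W\<close>; hence \<open>h \<le> D\<close> and \<open>q\<close> is nonnegative, as needed
    to multiply the induction hypothesis by \<open>q\<close>.\<close>
  have "x0 \<in> {x \<in> W. d x0 x \<le> R + real k}"
    using \<open>0 \<le> R\<close> x0 W_subset zero[of x0 x0] by auto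
  then have "0 < card {x \<in> W. d x0 x \<le> R + real k}" using finite_W by (auto simp: card_gt_0_iff)
  then have "2 \<le> card W" using small_k(2) by linarith
  then have "h\<^sup>2 \<le> D\<^sup>2" using h_le_D x0 h_pos by (intro power_mono) auto
  then have "0 \<le> q" unfolding q_def using D_pos by (simp add: field_simps) (smt (verit) zero_le_power2)
  then show ?case
    using step mult_left_mono[OF IH \<open>0 \<le> q\<close>] by (simp flip: q_def add: mult.assoc)
qed simp

end

section \<open>The path metric on vertices\<close>

lemma finite_graph_edgeE:
  assumes "finite_graph V E" "e \<in> E"
  obtains a b where "e = {a, b}" "a \<in> V" "b \<in> V" "a \<noteq> b"
  using assms unfolding finite_graph_def by blast

lemma finite_graph_edgeD:
  assumes "finite_graph V E" "{u, v} \<in> E"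
  shows "u \<in> V" "v \<in> V" "u \<noteq> v"
  using finite_graph_edgeE[OF assms] by (metis doubleton_eq_iff)+

lemma indicator_in_cell: "finite e \<Longrightarrow> v \<in> e \<Longrightarrow> indicator {v} \<in> cell e"
  by (auto simp: cell_def indicator_def sum.delta split: if_splits)

lemma cell_support: "p \<in> cell e \<Longrightarrow> v \<notin> e \<Longrightarrow> p v = 0"
  by (simp add: cell_def)

text \<open>Barycentric coordinates extend \<open>\<rho>\<close> affinely over the edges with slope
  at most 1, so the extension changes along a path by at most its length. Lower bounds on path
  lengths come from here.\<close>

lemma graph_path_Lipschitz:
  assumes "graph_path V E p q l" and fg: "finite_graph V E"
    and \<rho>: "\<And>a b. {a, b} \<in> E \<Longrightarrow> \<bar>\<rho> a - \<rho> b\<bar> \<le> (1::real)"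
  shows "\<bar>(\<Sum>v\<in>V. \<rho> v * p v) - (\<Sum>v\<in>V. \<rho> v * q v)\<bar> \<le> l"
  using assms(1)
proof (induction rule: graph_path.induct)
  case (step q l e r)
  from fg step.hyps(2) obtain a b where e: "e = {a, b}" "a \<in> V" "b \<in> V" "a \<noteq> b"
    by (rule finite_graph_edgeE)
  have sum_eq: "(\<Sum>v\<in>V. \<rho> v * s v) = \<rho> b + (\<rho> a - \<rho> b) * s a" "s b = 1 - s a"
    if "s \<in> cell e" for s
  proof -
    show sb: "s b = 1 - s a" using that e by (auto simp: cell_def)
    have "(\<Sum>v\<in>V. \<rho> v * s v) = (\<Sum>v\<in>e. \<rho> v * s v)"
      using fg e cell_support[OF that] by (intro sum.mono_neutral_right) (auto simp: finite_graph_def)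
    also have "\<dots> = \<rho> b + (\<rho> a - \<rho> b) * s a"
      using e by (simp add: sb algebra_simps)
    finally show "(\<Sum>v\<in>V. \<rho> v * s v) = \<rho> b + (\<rho> a - \<rho> b) * s a" .
  qed
  have "\<bar>(\<Sum>v\<in>V. \<rho> v * q v) - (\<Sum>v\<in>V. \<rho> v * r v)\<bar> = \<bar>\<rho> a - \<rho> b\<bar> * \<bar>q a - r a\<bar>"
    by (simp add: sum_eq(1)[OF step.hyps(3)] sum_eq(1)[OF step.hyps(4)] abs_mult[symmetric] algebra_simps)
  also have "\<dots> \<le> 1 * \<bar>q a - r a\<bar>"
    using \<rho> step.hyps(2) e by (intro mult_right_mono) auto
  also have "\<dots> = edge_dist e q r"
    using e(4) by (simp add: edge_dist_def e(1) sum_eq(2)[OF step.hyps(3)] sum_eq(2)[OF step.hyps(4)])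
  finally show ?case using step.IH by linarith
qed simp

lemma graph_path_nonneg: "graph_path V E p q l \<Longrightarrow> finite_graph V E \<Longrightarrow> 0 \<le> l"
  using graph_path_Lipschitz[of V E p q l "\<lambda>_. 0"] by simp

lemma indicator_in_realization: "v \<in> V \<Longrightarrow> indicator {v} \<in> realization V E"
  unfolding realization_def using indicator_in_cell[of "{v}" v] by auto

lemma graph_path_edge:
  assumes "finite_graph V E" "graph_path V E p (indicator {u}) l" "{u, v} \<in> E"
  shows "graph_path V E p (indicator {v}) (l + 1)"
proof -
  have "u \<noteq> v" using finite_graph_edgeD[OF assms(1,3)] by simp
  then have "edge_dist {u, v} (indicator {u}) (indicator {v}) = 1"
    by (simp add: edge_dist_def)
  with graph_path.step[OF assms(2,3), of "indicator {v}"] show ?thesis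
    by (simp add: indicator_in_cell)
qed

lemma path_metric_edge:
  assumes "finite_graph V E" "{u, v} \<in> E"
  shows "path_metric V E (indicator {u}) (indicator {v}) \<le> 1"
proof -
  have "u \<in> V" using finite_graph_edgeD[OF assms] by simp
  then have "graph_path V E (indicator {u}) (indicator {v}) 1"
    using graph_path_edge[OF assms(1) graph_path.refl assms(2)] indicator_in_realization[of u V E]
    by simp
  then show ?thesis
    unfolding path_metric_def using graph_path_nonneg[OF _ assms(1)]
    by (intro cInf_lower bdd_belowI[of _ 0]) auto
qed

section \<open>Combinatorial balls and their growth\<close>

text \<open>Metric paths may turn around inside an edge, so vertices are counted in balls defined by
  whole edges instead.\<close>

primrec graph_ball :: "'a set set \<Rightarrow> 'a \<Rightarrow> nat \<Rightarrow> 'a set" where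
  "graph_ball E u 0 = {u}"
| "graph_ball E u (Suc j) = graph_ball E u j \<union> (\<Union>x\<in>graph_ball E u j. {v. {x, v} \<in> E})"

lemma graph_ball_mono: "i \<le> j \<Longrightarrow> graph_ball E u i \<subseteq> graph_ball E u j"
  by (rule lift_Suc_mono_le[of "graph_ball E u"]) auto

lemma graph_ball_subset:
  assumes "finite_graph V E" "u \<in> V"
  shows "graph_ball E u j \<subseteq> V"
  by (induction j) (use assms finite_graph_edgeD in \<open>auto\<close>)

lemma card_neighbours_le:
  assumes "finite_graph V E"
  shows "card {v. {x, v} \<in> E} \<le> card {e \<in> E. x \<in> e}"
proof (rule card_inj_on_le[of "\<lambda>v. {x, v}"])
  have "E \<subseteq> Pow V" "finite V" using assms by (auto simp: finite_graph_def)
  then show "finite {e \<in> E. x \<in> e}" using finite_subset[of E "Pow V"] by simp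
qed (auto simp: inj_on_def doubleton_eq_iff)

text \<open>Each vertex of a ball contributes itself and at most \<open>D\<close> neighbours to the
  next ball.\<close>

lemma card_graph_ball_le:
  assumes fg: "finite_graph V E" and u: "u \<in> V"
    and deg: "\<And>v. v \<in> V \<Longrightarrow> card {e \<in> E. v \<in> e} \<le> D"
  shows "card (graph_ball E u j) \<le> (D + 1) ^ j"
proof (induction j)
  case (Suc j)
  let ?B = "graph_ball E u j"
  have B: "?B \<subseteq> V" by (rule graph_ball_subset[OF fg u])
  then have fin: "finite ?B" using fg finite_subset by (auto simp: finite_graph_def)
  have "card (\<Union>x\<in>?B. {v. {x, v} \<in> E}) \<le> (\<Sum>x\<in>?B. card {v. {x, v} \<in> E})"
    using fin by (rule card_UN_le)
  also have "\<dots> \<le> (\<Sum>x\<in>?B. D)"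
    using B card_neighbours_le[OF fg] deg by (intro sum_mono) (meson order_trans subsetD)
  finally have "card (\<Union>x\<in>?B. {v. {x, v} \<in> E}) \<le> card ?B * D" by simp
  then have "card (graph_ball E u (Suc j)) \<le> card ?B + card ?B * D"
    using card_Un_le[of ?B "\<Union>x\<in>?B. {v. {x, v} \<in> E}"] by simp
  also have "\<dots> = card ?B * (D + 1)" by simp
  also have "\<dots> \<le> (D + 1) ^ j * (D + 1)" using Suc by (intro mult_right_mono) auto
  finally show ?case by (simp add: mult.commute)
qed simp

text \<open>If \<open>v\<close> were outside the ball, a 1-Lipschitz function vanishing at
  \<open>u\<close> and equal to \<open>R + 1\<close> at \<open>v\<close> would force every path to
  have length at least \<open>R + 1\<close>.\<close>

lemma path_metric_le_imp_graph_ball: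
  assumes fg: "finite_graph V E" and uv: "u \<in> V" "v \<in> V"
    and conn: "same_component V E (indicator {u}) (indicator {v})"
    and le: "path_metric V E (indicator {u}) (indicator {v}) \<le> real R"
  shows "v \<in> graph_ball E u R"
proof (rule ccontr)
  assume v: "v \<notin> graph_ball E u R"
  \<comment> \<open>the combinatorial distance from \<open>u\<close>, truncated at \<open>R + 1\<close>\<close>
  define \<rho> where "\<rho> x = card {j. j \<le> R \<and> x \<notin> graph_ball E u j}" for x
  have step: "\<rho> b \<le> \<rho> a + 1" if "{a, b} \<in> E" for a b
  proof -
    \<comment> \<open>A ball of radius \<open>Suc i\<close> missing \<open>b\<close> forces the ball
      of radius \<open>i\<close> to miss the neighbour \<open>a\<close>; only radius 0 has no
      predecessor, which costs the one extra unit.\<close>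
    have "{j. j \<le> R \<and> b \<notin> graph_ball E u j} \<subseteq> insert 0 (Suc ` {j. j \<le> R \<and> a \<notin> graph_ball E u j})"
    proof safe
      fix j assume j: "j \<le> R" "b \<notin> graph_ball E u j" "j \<notin> Suc ` {j. j \<le> R \<and> a \<notin> graph_ball E u j}"
      show "j = 0"
      proof (cases j)
        case (Suc i)
        then have "a \<notin> graph_ball E u i" using j(2) that by auto
        with j Suc show ?thesis by auto
      qed
    qed
    then have "\<rho> b \<le> card (insert 0 (Suc ` {j. j \<le> R \<and> a \<notin> graph_ball E u j}))"
      unfolding \<rho>_def by (intro card_mono) auto
    also have "\<dots> \<le> \<rho> a + 1"
      by (subst card_insert_if) (auto simp: \<rho>_def card_image)
    finally show ?thesis .
  qed
  have lip: "\<bar>real (\<rho> a) - real (\<rho> b)\<bar> \<le> 1" if "{a, b} \<in> E" for a b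
    using step[of a b] step[of b a] that by (simp add: insert_commute abs_diff_le_iff)
  have "\<rho> v = R + 1"
  proof -
    have "{j. j \<le> R \<and> v \<notin> graph_ball E u j} = {..R}"
      using v graph_ball_mono[of _ R E u] by auto
    then show ?thesis by (simp add: \<rho>_def)
  qed
  moreover have "\<rho> u = 0"
  proof -
    have "u \<in> graph_ball E u j" for j using graph_ball_mono[of 0 j E u] by auto
    then show ?thesis by (simp add: \<rho>_def)
  qed
  moreover have "(\<Sum>x\<in>V. real (\<rho> x) * indicator {y} x) = \<rho> y" if "y \<in> V" for y
    using that fg by (simp add: indicator_def finite_graph_def of_bool_def if_distrib sum.delta cong: if_cong)
  ultimately have "real (R + 1) \<le> l" if "graph_path V E (indicator {u}) (indicator {v}) l" for l :: real
    using graph_path_Lipschitz[OF that fg, of "\<lambda>x. real (\<rho> x)"] lip uv by simp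
  \<comment> \<open>\<open>conn\<close> makes the set of lengths nonempty, so its infimum inherits
    the lower bound.\<close>
  then have "real (R + 1) \<le> path_metric V E (indicator {u}) (indicator {v})"
    unfolding path_metric_def using conn
    by (intro cInf_greatest) (auto simp: same_component_def)
  with le show False by simp
qed

section \<open>Consequences of the Cheeger bound\<close>

lemma cheeger_bound:
  assumes "ereal h \<le> cheeger V E" "finite V" "S \<subseteq> V" "S \<noteq> {}" "S \<noteq> V"
  shows "h * min (card S) (card (V - S)) \<le> card (edges_between E S (V - S))"
proof -
  have "cheeger V E \<le> ereal (card (edges_between E S (V - S)) / min (card S) (card (V - S)))"
    unfolding cheeger_def using assms by (intro INF_lower2[of "(S, V - S)"]) auto
  with assms(1) have "h \<le> card (edges_between E S (V - S)) / min (card S) (card (V - S))"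
    using order_trans ereal_less_eq(3) by blast
  moreover have "0 < min (card S) (card (V - S))"
    using assms finite_subset[of S V] by (auto simp: card_gt_0_iff)
  ultimately show ?thesis by (simp add: pos_le_divide_eq)
qed

text \<open>No edge leaves the component of \<open>u\<close>, so a proper component would have
  Cheeger quotient 0. Connectedness makes the path metric available between any two vertices of one
  graph.\<close>

lemma cheeger_pos_imp_connected:
  assumes fg: "finite_graph V E" and h: "0 < h" "ereal h \<le> cheeger V E"
    and uv: "u \<in> V" "v \<in> V"
  shows "same_component V E (indicator {u}) (indicator {v})"
proof (rule ccontr)
  assume not: "\<not> ?thesis"
  define S where "S = {x \<in> V. same_component V E (indicator {u}) (indicator {x})}"
  have u: "u \<in> S"
    using uv graph_path.refl[OF indicator_in_realization, of u V E] by (auto simp: S_def same_component_def)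
  have S: "S \<subseteq> V" "S \<noteq> {}" "S \<noteq> V" "finite V" using uv not u fg by (auto simp: S_def finite_graph_def)
  have "edges_between E S (V - S) = {}"
    using graph_path_edge[OF fg] by (force simp: edges_between_def S_def same_component_def)
  with cheeger_bound[OF h(2) S(4,1,2,3)] have "h * min (card S) (card (V - S)) \<le> 0" by simp
  moreover have "0 < min (card S) (card (V - S))"
    using S finite_subset[of S V] by (auto simp: card_gt_0_iff)
  ultimately show False using h(1) by (simp add: mult_le_0_iff)
qed

text \<open>Disjointness lets each cut edge come from exactly one ordered pair; this links the edge
  count to the double sum in \<open>expansion\<close>.\<close>

lemma card_edges_between:
  assumes "finite S" "finite T" "S \<inter> T = {}"
  shows "real (card (edges_between E S T)) = (\<Sum>x\<in>S. \<Sum>y\<in>T. of_bool ({x, y} \<in> E))"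
proof -
  let ?P = "{p \<in> S \<times> T. {fst p, snd p} \<in> E}"
  have "edges_between E S T = (\<lambda>p. {fst p, snd p}) ` ?P"
    unfolding edges_between_def image_def by fastforce
  moreover have "inj_on (\<lambda>p. {fst p, snd p}) ?P"
    using assms(3) by (auto simp: inj_on_def doubleton_eq_iff)
  ultimately have "card (edges_between E S T) = card ?P" by (simp add: card_image)
  also have "real \<dots> = (\<Sum>p\<in>S \<times> T. of_bool ({fst p, snd p} \<in> E))"
    using assms by (simp add: of_bool_def sum.If_cases Int_def)
  also have "\<dots> = (\<Sum>x\<in>S. \<Sum>y\<in>T. of_bool ({x, y} \<in> E))"
    by (simp add: sum.cartesian_product case_prod_unfold)
  finally show ?thesis .
qed

section \<open>Failure of localization\<close>

theorem theorem6p5: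
  fixes V :: "nat \<Rightarrow> 'a set" and E :: "nat \<Rightarrow> 'a set set"
    and d :: "nat \<times> ('a \<Rightarrow> real) \<Rightarrow> nat \<times> ('a \<Rightarrow> real) \<Rightarrow> real"
  assumes infinite_dimensional:
      "\<nexists>B :: 'h::{complex_hilbert_space, second_countable_topology} set.
         finite B \<and> module.span scaleC B = UNIV"
    and expanding: "expanding_graphs V E"
    and metric: "Metric_space (graph_union V E) d"
    and path_metric: "\<And>n p q. \<lbrakk>n \<ge> 1; same_component (V n) (E n) p q\<rbrakk>
           \<Longrightarrow> d (n, p) (n, q) = path_metric (V n) (E n) p q"
    and separated: "\<And>i j. \<lbrakk>i \<ge> 1; j \<ge> 1; i \<noteq> j\<rbrakk>
           \<Longrightarrow> set_distance d (graph_piece V E i) (graph_piece V E j) > ereal (real i + real j)"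
  shows "\<not> operator_norm_localization TYPE('h) (vertex_union V) d"
proof
  assume "operator_norm_localization TYPE('h) (vertex_union V) d"
  then obtain c :: real and f :: "nat \<Rightarrow> nat" where c: "0 < c" and
    loc: "\<And>\<nu> k T. locally_finite_borel_measure (vertex_union V) d \<nu> \<Longrightarrow>
      emeasure \<nu> (vertex_union V) \<noteq> 0 \<Longrightarrow> T \<in> propagation_at_most (vertex_union V) d \<nu> (real k) \<Longrightarrow>
      \<exists>\<phi>::nat \<times> ('a \<Rightarrow> real) \<Rightarrow> 'h. \<phi> \<in> L2 \<nu> \<and> \<not> (AE x in \<nu>. \<phi> x = 0) \<and>
        set_diameter d (L2_supp (vertex_union V) d \<nu> \<phi>) \<le> ereal (real (f k)) \<and>
        L2_norm \<nu> (T \<phi>) \<ge> c * L2_onorm \<nu> T * L2_norm \<nu> \<phi>"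
    unfolding operator_norm_localization_def by blast
  from expanding obtain D :: nat and h :: real where
    graph: "\<And>n. n \<ge> 1 \<Longrightarrow> finite_graph (V n) (E n)" and
    deg: "\<And>n v. n \<ge> 1 \<Longrightarrow> v \<in> V n \<Longrightarrow> card {e \<in> E n. v \<in> e} \<le> D" and
    h: "0 < h" "\<And>n. n \<ge> 1 \<Longrightarrow> ereal h \<le> cheeger (V n) (E n)" and
    lim: "filterlim (\<lambda>n. card (V n)) at_top sequentially"
    unfolding expanding_graphs_def by blast
  \<comment> \<open>The contraction factor for squared norms, with \<open>D + 1\<close> as a degree
    bound that is certainly positive.\<close>
  define q where "q = 1 - h\<^sup>2 / (4 * (real (D + 1))\<^sup>2)"
  have "q < 1" using h(1) by (simp add: q_def)
  then obtain k where k: "q ^ k < c\<^sup>2" using c real_arch_pow_inv[of "c\<^sup>2" q] by auto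
  \<comment> \<open>Twice the size bound for a ball of radius \<open>f k + k\<close>:
    \<open>f k\<close> for the localized vector and \<open>k\<close> for its spreading under the
    walk.\<close>
  define N where "N = 2 * (D + 1) ^ (f k + k)"
  from lim have "\<forall>\<^sub>F n in sequentially. max N 1 \<le> card (V n)"
    unfolding filterlim_at_top by blast
  then obtain n where n: "1 \<le> n" "N \<le> card (V n)" "1 \<le> card (V n)"
    unfolding eventually_sequentially by (metis max.bounded_iff max.cobounded1 max.cobounded2)
  note fg = graph[OF n(1)]
  define \<iota> where "\<iota> v = (n, indicator {v} :: 'a \<Rightarrow> real)" for v
  define W where "W = \<iota> ` V n"
  \<comment> \<open>The adjacency matrix of the chosen graph, transported to the disjoint union by
    \<open>\<iota>\<close>.\<close>
  define w :: "nat \<times> ('a \<Rightarrow> real) \<Rightarrow> nat \<times> ('a \<Rightarrow> real) \<Rightarrow> real"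
    where "w x y = of_bool ({x, y} \<in> (`) \<iota> ` E n)" for x y
  have inj: "inj \<iota>"
  proof (rule injI)
    fix u v assume "\<iota> u = \<iota> v"
    then have "indicator {u} u = (indicator {v} u :: real)" by (metis \<iota>_def snd_conv)
    then show "u = v" by (simp split: split_indicator_asm)
  qed
  have w_\<iota>: "w (\<iota> u) (\<iota> v) = of_bool ({u, v} \<in> E n)" for u v
  proof -
    have "inj ((`) \<iota>)" using inj by (simp add: inj_def inj_image_eq_iff)
    then have "\<iota> ` {u, v} \<in> (`) \<iota> ` E n \<longleftrightarrow> {u, v} \<in> E n" by (rule inj_image_mem_iff)
    then show ?thesis by (simp add: w_def)
  qed
  have sum_\<iota>: "(\<Sum>x\<in>\<iota> ` S. F x) = (\<Sum>v\<in>S. F (\<iota> v))" for S and F :: "_ \<Rightarrow> real"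
    using inj by (subst sum.reindex) (auto intro: inj_on_subset)
  have card_\<iota>: "card (\<iota> ` S) = card S" for S
    using inj by (intro card_image) (auto intro: inj_on_subset)
  have d_\<iota>: "d (\<iota> u) (\<iota> v) = path_metric (V n) (E n) (indicator {u}) (indicator {v})"
    if "u \<in> V n" "v \<in> V n" for u v
    unfolding \<iota>_def using path_metric n(1) cheeger_pos_imp_connected[OF fg h(1) h(2) that] by simp
  have vertex_subset: "vertex_union V \<subseteq> graph_union V E"
    by (auto simp: vertex_union_def graph_union_def graph_piece_def indicator_in_realization)
  interpret Metric_space "vertex_union V" d
    using Metric_space.subspace[OF metric vertex_subset] .
  interpret edge_expander W w "real (D + 1)" h
  proof
    show "finite W" using fg by (simp add: W_def finite_graph_def)
    show "0 \<le> w x y" for x y by (simp add: w_def)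
    show "w x y = w y x" for x y by (simp add: w_def insert_commute)
    show "(\<Sum>y\<in>W. w x y) \<le> real (D + 1)" if x: "x \<in> W" for x
    proof -
      from x obtain u where u: "x = \<iota> u" "u \<in> V n" by (auto simp: W_def)
      have eq: "V n \<inter> {v. {u, v} \<in> E n} = {v. {u, v} \<in> E n}" using finite_graph_edgeD[OF fg] by auto
      have "(\<Sum>y\<in>W. w x y) = card {v. {u, v} \<in> E n}"
        using fg by (simp add: W_def sum_\<iota> u w_\<iota> of_bool_def sum.If_cases finite_graph_def eq)
      also have "\<dots> \<le> D + 1"
        using card_neighbours_le[OF fg, of u] deg[OF n(1) u(2)] by linarith
      finally show ?thesis by simp
    qed
    show "h * real (card S) \<le> (\<Sum>x\<in>S. \<Sum>y\<in>W - S. w x y)"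
      if S: "S \<subseteq> W" "2 * card S \<le> card W" for S
    proof (cases "S = {}")
      case False
      from S(1) obtain U where U: "S = \<iota> ` U" "U \<subseteq> V n" unfolding W_def by (meson subset_imageE)
      have fin: "finite (V n)" using fg by (simp add: finite_graph_def)
      have WS: "W - S = \<iota> ` (V n - U)"
        unfolding W_def U using inj by (simp add: image_set_diff)
      have U2: "2 * card U \<le> card (V n)" using S(2) by (simp add: U(1) W_def card_\<iota>)
      have card_diff: "card (V n - U) = card (V n) - card U"
        using U(2) fin by (simp add: card_Diff_subset finite_subset)
      have "U \<noteq> V n" "U \<noteq> {}" using U2 n(3) False U(1) by auto
      then have "h * min (card U) (card (V n - U)) \<le> card (edges_between (E n) U (V n - U))"
        using cheeger_bound[OF h(2)[OF n(1)] fin U(2)] by simp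
      also have "min (card U) (card (V n - U)) = card U" using U2 card_diff by simp
      also have "real (card (edges_between (E n) U (V n - U))) = (\<Sum>x\<in>S. \<Sum>y\<in>W - S. w x y)"
        unfolding WS using U fin finite_subset
        by (subst card_edges_between) (auto simp: sum_\<iota> w_\<iota>)
      finally show ?thesis by (simp add: U(1) card_\<iota>)
    qed simp
  qed (use h(1) in auto)
  interpret metric_expander W w "real (D + 1)" h "vertex_union V" d
  proof
    show "W \<subseteq> vertex_union V" using n(1) by (auto simp: W_def \<iota>_def vertex_union_def)
    show "W \<noteq> {}" using n(3) by (auto simp: W_def)
    show "d x y \<le> 1" if "x \<in> W" "y \<in> W" "w x y \<noteq> 0" for x y
      using that path_metric_edge[OF fg] by (auto simp: W_def w_\<iota> d_\<iota>)
    \<comment> \<open>The graph containing \<open>x\<close> has finitely many vertices, and every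
      other graph is at distance more than 2.\<close>
    show "openin mtopology {x}" if x: "x \<in> vertex_union V" for x
    proof -
      from x obtain m v where m: "m \<ge> 1" "v \<in> V m" "x = (m, indicator {v})"
        by (auto simp: vertex_union_def)
      define P where "P = (\<lambda>u. (m, indicator {u} :: 'a \<Rightarrow> real)) ` V m - {x}"
      \<comment> \<open>Inserting 1 covers an empty \<open>P\<close> and keeps the ball away from
        the other graphs.\<close>
      define r where "r = Min (insert 1 (d x ` P))"
      have fin: "finite P" using graph[OF m(1)] by (simp add: P_def finite_graph_def)
      have P: "P \<subseteq> vertex_union V" using m(1) by (auto simp: P_def vertex_union_def)
      have "0 < d x y" if "y \<in> P" for y
        using that P x nonneg[of x y] zero[of x y] by (auto simp: P_def less_le)
      then have "0 < r" using fin by (auto simp: r_def)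
      moreover have "mball x r \<subseteq> {x}"
      proof
        fix y assume "y \<in> mball x r"
        then have y: "y \<in> vertex_union V" "d x y < r" by auto
        then have lt: "d x y < 1" "\<And>z. z \<in> P \<Longrightarrow> d x y < d x z" using fin by (auto simp: r_def)
        from y(1) obtain j u where j: "j \<ge> 1" "u \<in> V j" "y = (j, indicator {u})"
          by (auto simp: vertex_union_def)
        have "j = m"
        proof (rule ccontr)
          assume "j \<noteq> m"
          then have "ereal (real m + real j) < set_distance d (graph_piece V E m) (graph_piece V E j)"
            using separated m(1) j(1) by auto
          also have "\<dots> \<le> ereal (d x y)"
            unfolding set_distance_def using m j
            by (intro INF_lower2[of x] INF_lower2[of y])
              (auto simp: graph_piece_def indicator_in_realization)
          finally show False using lt(1) m(1) j(1) by simp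
        qed
        then show "y \<in> {x}" using lt(2)[of y] j by (auto simp: P_def)
      qed
      ultimately show ?thesis using x by (auto simp: openin_mtopology)
    qed
  qed
  from loc[OF locally_finite_counting_on emeasure_counting_on_nonzero walk_propagation, of k]
  obtain \<phi> :: "nat \<times> ('a \<Rightarrow> real) \<Rightarrow> 'h" where
    nz: "\<not> (AE x in \<nu>. \<phi> x = 0)" and
    diam: "set_diameter d {x \<in> W. \<phi> x \<noteq> 0} \<le> ereal (real (f k))" and
    big: "c * L2_onorm \<nu> (walk ^^ k :: (_ \<Rightarrow> 'h) \<Rightarrow> _) * L2_norm \<nu> \<phi> \<le> L2_norm \<nu> ((walk ^^ k) \<phi>)"
    unfolding L2_supp_counting_on by blast
  from nz obtain x0 where x0: "x0 \<in> W" "\<phi> x0 \<noteq> 0" using W_subset by (auto simp: AE_counting_on)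
  obtain u where u: "u \<in> V n" "x0 = \<iota> u" using x0(1) by (auto simp: W_def)
  have supp: "d x0 x \<le> real (f k)" if "x \<in> W" "\<phi> x \<noteq> 0" for x
  proof -
    have "ereal (d x0 x) \<le> set_diameter d {x \<in> W. \<phi> x \<noteq> 0}"
      unfolding set_diameter_def using that x0 by (intro SUP_upper2[of x0] SUP_upper2[of x]) auto
    also note diam
    finally show ?thesis by simp
  qed
  \<comment> \<open>Bounded degree enters here: the ball reached in \<open>k\<close> steps has a
    size independent of \<open>n\<close>, hence at most half of \<open>V n\<close>.\<close>
  have "{x \<in> W. d x0 x \<le> real (f k) + real k} \<subseteq> \<iota> ` graph_ball (E n) u (f k + k)"
    using path_metric_le_imp_graph_ball[OF fg u(1), of _ "f k + k"]
      cheeger_pos_imp_connected[OF fg h(1) h(2)[OF n(1)] u(1)] u d_\<iota>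
    by (auto simp: W_def)
  moreover have "finite (graph_ball (E n) u (f k + k))"
    using graph_ball_subset[OF fg u(1)] fg finite_subset unfolding finite_graph_def by metis
  ultimately have "card {x \<in> W. d x0 x \<le> real (f k) + real k} \<le> card (graph_ball (E n) u (f k + k))"
    unfolding card_\<iota>[of "graph_ball (E n) u (f k + k)", symmetric]
    by (intro card_mono finite_imageI)
  also have "\<dots> \<le> (D + 1) ^ (f k + k)"
    using card_graph_ball_le[OF fg u(1) deg[OF n(1)]] .
  finally have small: "2 * card {x \<in> W. d x0 x \<le> real (f k) + real k} \<le> card W"
    using n(2) by (simp add: N_def W_def card_\<iota>)
  have upper: "(L2_norm \<nu> ((walk ^^ k) \<phi>))\<^sup>2 \<le> q ^ k * (L2_norm \<nu> \<phi>)\<^sup>2"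
    unfolding q_def using supp x0(1) small by (intro L2_norm_funpow_walk_small_support) auto
  have "0 < (\<Sum>x\<in>W. (norm (\<phi> x))\<^sup>2)"
    using x0 finite_W by (intro sum_pos2[of _ x0]) auto
  then have pos: "0 < L2_norm \<nu> \<phi>" by (simp add: L2_norm_counting_on)
  obtain v :: 'h where "v \<noteq> 0" using ex_nonzero_vector[OF infinite_dimensional] by blast
  then have "c * 1 * L2_norm \<nu> \<phi> \<le> c * L2_onorm \<nu> (walk ^^ k :: (_ \<Rightarrow> 'h) \<Rightarrow> _) * L2_norm \<nu> \<phi>"
    using c pos by (intro mult_right_mono mult_left_mono L2_onorm_walk_ge_1) auto
  with big have "c * L2_norm \<nu> \<phi> \<le> L2_norm \<nu> ((walk ^^ k) \<phi>)" by simp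
  then have "(c * L2_norm \<nu> \<phi>)\<^sup>2 \<le> (L2_norm \<nu> ((walk ^^ k) \<phi>))\<^sup>2"
    using c pos by (intro power_mono) auto
  \<comment> \<open>Cancelling the positive norm contradicts the choice of \<open>k\<close>.\<close>
  with upper have "c\<^sup>2 * (L2_norm \<nu> \<phi>)\<^sup>2 \<le> q ^ k * (L2_norm \<nu> \<phi>)\<^sup>2"
    by (simp add: power_mult_distrib)
  with k pos show False by simp
qed

end
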